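(* Fix $\lambda\in\mathbb{R}$. (1) For any $\varepsilon>0$ and $\beta>0$ there exists $A=A(\varepsilon,\beta,\lambda)<\infty$ such that for every graph $G$ on $n$ vertices with maximum degree at most $d\in[3,n-1]$ and every $0<p<1$ with $p\le\frac{1+\lambda n^{-1/3}}{d-1}$, $$\mathbf{P}\big(\exists\, \mathcal{C}\in\mathbf{CO}(G_p)\text{ with } \mathrm{diam}(\mathcal{C})>A n^{1/3}\big)<\varepsilon.$$ (2) For any $D_1>0$ there exists $D_2=D_2(D_1,\lambda)>0$ such that for every such $G$, $n$, $d$, $p$ and all $0<M<n^{2/3}/2$, $$\mathbf{P}\Big(\exists\, \mathcal{C}\in\mathbf{CO}(G_p):\ |\mathcal{C}|<M \text{ and } \mathrm{diam}(\mathcal{C})>D_2\sqrt{M\log(n/M^{3/2})}\Big)\le\Big(\frac{M^{3/2}}{n}\Big)^{D_1}.$$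
   Context: For a finite graph $G$ and $p\in(0,1)$, $G_p$ is the random subgraph obtained by bond percolation: each edge of $G$ is independently retained with probability $p$ and erased with probability $1-p$. $\mathbf{CO}(G_p)$ is the collection of connected components of $G_p$. For $\mathcal{C}\in\mathbf{CO}(G_p)$, $|\mathcal{C}|$ is its number of vertices and $\mathrm{diam}(\mathcal{C})$ is its graph-distance diameter. *)

theory Defs
  imports "HOL-Probability.Probability"
begin

definition simple_graph :: "'a set \<Rightarrow> 'a set set \<Rightarrow> bool" where
  "simple_graph V E \<longleftrightarrow> finite V \<and> (\<forall>e\<in>E. e \<subseteq> V \<and> card e = 2)"

definition vertex_degree :: "'a set set \<Rightarrow> 'a \<Rightarrow> nat" where
  "vertex_degree E v = card {e \<in> E. v \<in> e}"

definition adj :: "'a set set \<Rightarrow> ('a \<times> 'a) set" where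
  "adj E = {(u, v). {u, v} \<in> E}"

(* A component is represented by its vertex set; as a graph it is the subgraph induced on that set. *)
definition graph_components :: "'a set \<Rightarrow> 'a set set \<Rightarrow> 'a set set" where
  "graph_components V E = V // (adj E)\<^sup>*"

definition induced_edges :: "'a set set \<Rightarrow> 'a set \<Rightarrow> 'a set set" where
  "induced_edges E C = {e \<in> E. e \<subseteq> C}"

(* Length of a shortest walk; unspecified if u and v lie in different components. *)
definition graph_dist :: "'a set set \<Rightarrow> 'a \<Rightarrow> 'a \<Rightarrow> nat" where
  "graph_dist E u v = (LEAST k. (u, v) \<in> adj E ^^ k)"

(* Only meaningful for a nonempty finite connected graph (V, E). *)
definition graph_diam :: "'a set \<Rightarrow> 'a set set \<Rightarrow> nat" where
  "graph_diam V E = Max {graph_dist E u v | u v. u \<in> V \<and> v \<in> V}"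

definition component_diam :: "'a set set \<Rightarrow> 'a set \<Rightarrow> nat" where
  "component_diam E C = graph_diam C (induced_edges E C)"

(* The law of the random edge set of G_p; its vertex set is that of G. *)
definition percolation :: "'a set set \<Rightarrow> real \<Rightarrow> 'a set set pmf" where
  "percolation E p =
     map_pmf (\<lambda>\<omega>. {e \<in> E. \<omega> e}) (Pi_pmf E False (\<lambda>_. bernoulli_pmf p))"

end

theory Submission
  imports Defs
begin

text \<open>
  The component of a vertex \<open>v\<close> is explored level by level: the next level consists of the new
  vertices joined to the current level \<open>S\<close> by a retained edge, after which all edges touching \<open>S\<close>
  are discarded. Every vertex beyond the root has at most \<open>D = d - 1\<close> edges left, and the
  discarded and the remaining edges are independent, so the level sizes are dominated by a
  branching process with offspring law Binomial \<open>(D, p)\<close>. A component of diameter more than \<open>R\<close>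
  survives, seen from any of its vertices, for more than \<open>R / 2\<close> levels, so the task is to bound
  the probability of long survival together with a small total size.

  The domination is used through the test functions \<open>1 - (1 - q) ^ w\<close>, where \<open>w\<close> is the size of
  a level. If \<open>p * D \<le> 1 + q / 8\<close>, averaging over one level turns the parameter \<open>q\<close> into at most
  \<open>q - q\<^sup>2 / 8\<close> (\<open>bfs_front_prob_step\<close>): the variance of the offspring number beats the slight
  supercriticality. This has two consequences. First, starting with parameter 1, after \<open>k\<close> levels
  the survival probability of one vertex is of order \<open>max q (1 / k)\<close> (\<open>prob_survives_le_max\<close>).
  Secondly, with \<open>q\<close> kept fixed, each further level multiplies the bound by at most
  \<open>exp (- q / 8 + q\<^sup>2 w / 8)\<close> (\<open>survival_drift\<close>). The second term is paid for by the number of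
  explored vertices, and so surviving \<open>8 / q + j\<close> levels with at most \<open>b\<close> vertices has
  probability of order \<open>q exp (- q j / 8 + q\<^sup>2 b / 4)\<close>. For \<open>b = M\<close> and \<open>q = r / (4 M)\<close> this is
  \<open>(r / M) exp (- r\<^sup>2 / (64 M))\<close> up to a constant (\<open>prob_survives_singleton_le\<close>).

  A component of large diameter with between \<open>M / 2\<close> and \<open>M\<close> vertices
  contributes at least \<open>M / 2\<close> starting points whose exploration survives long and
  stays small, so Markov's inequality bounds the probability that such a component exists by
  \<open>2 / M\<close> times a sum over the vertices. Halving \<open>M\<close> repeatedly gives
  \<open>prob_small_components_le\<close>, which is already the second claim up to the choice of
  \<open>D2\<close>. For the first claim, components with fewer than \<open>B n powr
  (2/3)\<close> vertices are handled in the same way. A larger one of large diameter would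
  contain \<open>B n powr (2/3)\<close> vertices, each surviving \<open>n powr (1/3)\<close>
  levels, an event of probability \<open>O(n powr (-1/3))\<close> for each vertex, so that
  Markov's inequality leaves \<open>O(1 / B)\<close>.
\<close>

section \<open>The offspring inequalities\<close>

text \<open>Among binomial laws with a given mean and at least two trials, the one with exactly two is the extreme case for the
  probability that nothing happens. Working with the square root of \<open>1 - y\<close> makes this provable
  by induction over all \<open>D\<close>, odd ones included.\<close>
lemma one_minus_power_ge_square:
  fixes y x :: real and D :: nat
  assumes y: "0 \<le> y" "y \<le> 1" and D: "2 \<le> D" and Dy: "real D * y \<le> x" and x: "x \<le> 2"
  shows "(1 - x / 2)\<^sup>2 \<le> (1 - y) ^ D"
proof -
  define z where "z = sqrt (1 - y)"
  have z: "0 \<le> z" "z \<le> 1" and z2: "z\<^sup>2 = 1 - y" using y by (auto simp: z_def)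
  have "1 - real D / 2 * (1 - z\<^sup>2) \<le> z ^ D"
    using D
  proof (induction D rule: dec_induct)
    case base
    then show ?case by simp
  next
    case (step k)
    have "z ^ k \<le> z ^ 1" using step z by (intro power_decreasing) auto
    then have "z ^ k \<le> (1 + z) / 2" using z by simp
    then have "(1 - z) * z ^ k \<le> (1 - z) * ((1 + z) / 2)" using z by (intro mult_left_mono) auto
    then show ?case using step.IH by (simp add: field_simps power2_eq_square)
  qed
  then have "1 - x / 2 \<le> z ^ D" using Dy z2 by simp
  then have "(1 - x / 2)\<^sup>2 \<le> (z ^ D)\<^sup>2" using x by (intro power_mono) auto
  also have "\<dots> = (1 - y) ^ D" by (metis power_mult mult.commute z2)
  finally show ?thesis .
qed

text \<open>This is the only place where criticality enters: an individual with \<open>D \<ge> 2\<close> potential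
  children, each present with probability \<open>p\<close> and then successful with probability \<open>q\<close>, has a
  successful child with probability at most \<open>q - q\<^sup>2 / 8\<close>. The excess \<open>q / 8\<close> of the mean costs \<open>q\<^sup>2 / 8\<close>,
  while the chance of two successful children gains about \<open>q\<^sup>2 / 4\<close>.\<close>
lemma offspring_survival_contracts:
  fixes p q :: real and D :: nat
  assumes p: "0 \<le> p" "p \<le> 1" and q: "0 \<le> q" "q \<le> 1" and D: "2 \<le> D"
    and pD: "p * real D \<le> 1 + q / 8"
  shows "1 - (q - q\<^sup>2 / 8) \<le> (1 - p * q) ^ D"
proof -
  define x where "x = q + q\<^sup>2 / 8"
  have qq: "q\<^sup>2 \<le> 1" "0 \<le> q\<^sup>2" using q by (auto simp: power_le_one)
  have "real D * (p * q) \<le> x"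
    using mult_right_mono[OF pD q(1)] by (simp add: x_def power2_eq_square algebra_simps)
  moreover have "x \<le> 2" using q qq by (simp add: x_def)
  moreover have "p * q \<le> 1" using p q by (simp add: mult_le_one)
  ultimately have "(1 - x / 2)\<^sup>2 \<le> (1 - p * q) ^ D"
    using p q D by (intro one_minus_power_ge_square) auto
  moreover have "q\<^sup>2 \<le> x\<^sup>2" using q qq by (intro power_mono) (auto simp: x_def)
  then have "1 - (q - q\<^sup>2 / 8) \<le> (1 - x / 2)\<^sup>2"
    by (simp add: x_def power2_eq_square algebra_simps)
  ultimately show ?thesis by linarith
qed

text \<open>The gain from \<open>q\<close> to \<open>q - q\<^sup>2 / 8\<close> is a factor \<open>1 - q / 8\<close> when \<open>w = 1\<close>, but it fades away once
  \<open>w\<close> is of order \<open>1 / q\<close>, because a crowded level is likely to survive anyway. The term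
  \<open>q\<^sup>2 / 8 * w\<close> compensates for this loss, in a form that adds up over the levels to the
  total number of explored vertices.\<close>
lemma survival_drift:
  fixes q :: real and w :: nat
  assumes q: "0 \<le> q" "q \<le> 1"
  shows "1 - (1 - (q - q\<^sup>2 / 8)) ^ w \<le> (1 - (1 - q) ^ w) * exp (- q / 8 + q\<^sup>2 / 8 * real w)"
proof -
  define t \<delta> T where "t = 1 - q" and "\<delta> = q\<^sup>2 / 8" and "T = t ^ w"
  have t: "0 \<le> t" "t \<le> 1" and \<delta>: "0 \<le> \<delta>" using q by (auto simp: t_def \<delta>_def)
  have T: "0 \<le> T" "T \<le> 1" using t by (auto simp: T_def power_le_one)
  have grow: "T + real w * \<delta> * T \<le> (t + \<delta>) ^ w"
  proof -
    have "t ^ w + real w * \<delta> * t ^ w \<le> (t + \<delta>) ^ w"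
    proof (induction w)
      case 0
      then show ?case by simp
    next
      case (Suc w)
      have "t ^ Suc w + real (Suc w) * \<delta> * t ^ Suc w
          \<le> (t + \<delta>) * (t ^ w + real w * \<delta> * t ^ w)"
      proof -
        have "\<delta> * (t * t ^ w) \<le> \<delta> * t ^ w"
          using t \<delta> by (intro mult_left_mono) (auto simp: mult_left_le_one_le)
        moreover have "0 \<le> \<delta> * (real w * \<delta> * t ^ w)" using t \<delta> by simp
        ultimately show ?thesis by (simp add: algebra_simps)
      qed
      also have "\<dots> \<le> (t + \<delta>) * (t + \<delta>) ^ w" using Suc t \<delta> by (intro mult_left_mono) auto
      finally show ?case by simp
    qed
    then show ?thesis by (simp add: T_def)
  qed
  have bern: "1 - real w * q \<le> T"
    using Bernoulli_inequality[of "-q" w] q by (simp add: T_def t_def)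
  have "(1 - T) * (q / 8 - q\<^sup>2 / 8 * real w) \<le> real w * \<delta> * T"
  proof (cases "real w * q \<le> 1")
    case True
    have eq: "q / 8 - q\<^sup>2 / 8 * real w = q / 8 * (1 - real w * q)"
      by (simp add: power2_eq_square algebra_simps)
    have "(1 - T) * (q / 8 - q\<^sup>2 / 8 * real w) \<le> (real w * q) * (q / 8 - q\<^sup>2 / 8 * real w)"
      unfolding eq using bern True q by (intro mult_right_mono) auto
    also have "\<dots> = real w * \<delta> * (1 - real w * q)" by (simp add: \<delta>_def power2_eq_square algebra_simps)
    also have "\<dots> \<le> real w * \<delta> * T" using bern \<delta> by (intro mult_left_mono) auto
    finally show ?thesis .
  next
    case False
    have "q * 1 \<le> q * (real w * q)" using False q by (intro mult_left_mono) auto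
    then have "q / 8 - q\<^sup>2 / 8 * real w \<le> 0" by (simp add: power2_eq_square algebra_simps)
    then have "(1 - T) * (q / 8 - q\<^sup>2 / 8 * real w) \<le> 0" using T by (simp add: mult_nonneg_nonpos)
    also have "0 \<le> real w * \<delta> * T" using T \<delta> by simp
    finally show ?thesis .
  qed
  then have "1 - (t + \<delta>) ^ w \<le> (1 - T) * (1 + (- q / 8 + q\<^sup>2 / 8 * real w))"
    using grow by (simp add: field_simps)
  also have "\<dots> \<le> (1 - T) * exp (- q / 8 + q\<^sup>2 / 8 * real w)"
    using T by (intro mult_left_mono exp_ge_add_one_self) auto
  finally show ?thesis by (simp add: t_def \<delta>_def T_def algebra_simps)
qed

section \<open>Level-by-level exploration\<close>

definition next_level :: "'a set set \<Rightarrow> 'a set \<Rightarrow> 'a set" where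
  "next_level F S = {u. u \<notin> S \<and> (\<exists>s\<in>S. {s, u} \<in> F)}"

definition touching :: "'a set set \<Rightarrow> 'a set \<Rightarrow> 'a set set" where
  "touching F S = {e \<in> F. e \<inter> S \<noteq> {}}"

definition avoiding :: "'a set set \<Rightarrow> 'a set \<Rightarrow> 'a set set" where
  "avoiding F S = {e \<in> F. e \<inter> S = {}}"

text \<open>The recursion follows the exploration, so that one unfolding exposes one level: after a step,
  everything depends on the edges avoiding \<open>S\<close> only, which are independent of the edges that
  determined the new level.\<close>
fun survives :: "'a set set \<Rightarrow> 'a set \<Rightarrow> nat \<Rightarrow> bool" where
  "survives F S 0 \<longleftrightarrow> S \<noteq> {}"
| "survives F S (Suc k) \<longleftrightarrow> survives (avoiding F S) (next_level F S) k"

fun explored :: "'a set set \<Rightarrow> 'a set \<Rightarrow> nat \<Rightarrow> nat" where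
  "explored F S 0 = card S"
| "explored F S (Suc k) = card S + explored (avoiding F S) (next_level F S) k"

lemma next_level_subset_reach: "next_level F S \<subseteq> (adj F)\<^sup>* `` S"
  by (auto simp: next_level_def adj_def)

lemma adj_avoiding_subset: "adj (avoiding F S) \<subseteq> adj F"
  by (auto simp: adj_def avoiding_def)

lemma reach_avoiding_disjoint:
  assumes "(x, u) \<in> (adj (avoiding F S))\<^sup>*" "x \<notin> S"
  shows "u \<notin> S"
  using assms by (induction) (auto simp: adj_def avoiding_def)

text \<open>A path leaving \<open>S\<close> can be cut after its last visit to \<open>S\<close>; what remains starts in the next
  level and avoids \<open>S\<close>.\<close>
lemma reach_cases:
  assumes "(s, u) \<in> (adj F)\<^sup>*" "s \<in> S"
  shows "u \<in> S \<or> u \<in> (adj (avoiding F S))\<^sup>* `` next_level F S"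
  using assms
proof (induction)
  case base
  then show ?case by simp
next
  case (step y z)
  then consider "z \<in> S" | "z \<notin> S" "y \<in> S" | "z \<notin> S" "y \<in> (adj (avoiding F S))\<^sup>* `` next_level F S"
    by blast
  then show ?case
  proof cases
    case 2
    then have "z \<in> next_level F S" using step.hyps by (auto simp: next_level_def adj_def)
    then show ?thesis by blast
  next
    case 3
    then obtain x where x: "x \<in> next_level F S" "(x, y) \<in> (adj (avoiding F S))\<^sup>*" by blast
    then have "y \<notin> S" using reach_avoiding_disjoint by (fastforce simp: next_level_def)
    then have "(y, z) \<in> adj (avoiding F S)" using step.hyps 3 by (auto simp: adj_def avoiding_def)
    with x have "(x, z) \<in> (adj (avoiding F S))\<^sup>*" by simp
    then show ?thesis using x by blast
  qed simp
qed

lemma explored_le_card_reach: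
  assumes "finite ((adj F)\<^sup>* `` S)"
  shows "explored F S k \<le> card ((adj F)\<^sup>* `` S)"
  using assms
proof (induction k arbitrary: F S)
  case 0
  then show ?case by (auto intro: card_mono)
next
  case (Suc k)
  let ?R = "(adj F)\<^sup>* `` S" and ?R' = "(adj (avoiding F S))\<^sup>* `` next_level F S"
  have sub: "S \<union> ?R' \<subseteq> ?R"
  proof -
    have "?R' \<subseteq> (adj F)\<^sup>* `` ?R"
      by (intro Image_mono rtrancl_mono next_level_subset_reach adj_avoiding_subset)
    then show ?thesis by (blast intro: rtrancl_trans)
  qed
  have fin: "finite S" "finite ?R'" using finite_subset[OF sub Suc.prems] by auto
  have "S \<inter> ?R' = {}"
    using reach_avoiding_disjoint[of _ _ F S] by (fastforce simp: next_level_def)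
  then have "card S + card ?R' = card (S \<union> ?R')" using fin by (simp add: card_Un_disjoint)
  also have "\<dots> \<le> card ?R" by (rule card_mono[OF Suc.prems sub])
  finally show ?case using Suc.IH[OF fin(2)] by simp
qed

lemma relpow_mono_rel:
  fixes r s :: "('a \<times> 'a) set"
  assumes "r \<subseteq> s"
  shows "r ^^ j \<subseteq> s ^^ j"
  by (induction j) (use assms in auto)

text \<open>The levels are the distance spheres around \<open>S\<close>: one exploration step lowers by one the
  distance from the current level to a fixed unexplored vertex.\<close>
lemma survives_if_far:
  assumes "u \<in> (adj F)\<^sup>* `` S" "\<And>j. j < k \<Longrightarrow> u \<notin> (adj F ^^ j) `` S"
  shows "survives F S k"
  using assms
proof (induction k arbitrary: F S)
  case 0
  then show ?case by auto
next
  case (Suc k)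
  have "u \<notin> S" using Suc.prems(2)[of 0] by auto
  then have reach: "u \<in> (adj (avoiding F S))\<^sup>* `` next_level F S"
    using Suc.prems(1) reach_cases[of _ u F S] by blast
  have "u \<notin> (adj (avoiding F S) ^^ j) `` next_level F S" if "j < k" for j
  proof
    assume "u \<in> (adj (avoiding F S) ^^ j) `` next_level F S"
    then obtain x where x: "x \<in> next_level F S" "(x, u) \<in> adj (avoiding F S) ^^ j" by blast
    obtain s where s: "s \<in> S" "(s, x) \<in> adj F" using x by (auto simp: next_level_def adj_def)
    have "(x, u) \<in> adj F ^^ j" using x relpow_mono_rel[OF adj_avoiding_subset] by blast
    with s have "(s, u) \<in> adj F ^^ Suc j" by (intro relpow_Suc_I2)
    then show False using Suc.prems(2)[of "Suc j"] s that by blast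
  qed
  then show ?case using Suc.IH[OF reach] by simp
qed

lemma Suc_le_explored:
  assumes "finite F" "\<And>e. e \<in> F \<Longrightarrow> card e = 2" "finite S" "survives F S k"
  shows "Suc k \<le> explored F S k"
  using assms
proof (induction k arbitrary: F S)
  case 0
  then show ?case by (auto simp: Suc_le_eq card_gt_0_iff)
next
  case (Suc k)
  have fin: "finite (avoiding F S)" using Suc.prems by (simp add: avoiding_def)
  have "next_level F S \<subseteq> \<Union>F" by (auto simp: next_level_def)
  moreover have "finite (\<Union>F)"
    using Suc.prems(1,2) card.infinite by (intro finite_Union) fastforce+
  ultimately have "Suc k \<le> explored (avoiding F S) (next_level F S) k"
    using Suc.prems fin finite_subset by (intro Suc.IH) (auto simp: avoiding_def)
  moreover have "S \<noteq> {}"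
  proof
    assume "S = {}"
    then have "next_level F S = {}" by (simp add: next_level_def)
    moreover have "\<not> survives G {} k" for G :: "'a set set"
      by (induction k arbitrary: G) (simp_all add: next_level_def)
    ultimately show False using Suc.prems by simp
  qed
  then have "0 < card S" using Suc.prems by (simp add: card_gt_0_iff)
  ultimately show ?case by simp
qed

lemma sym_adj: "sym (adj F)"
  by (auto simp: sym_def adj_def insert_commute)

lemma component_eq_reach:
  assumes C: "C \<in> graph_components V F" and v: "v \<in> C"
  shows "C = (adj F)\<^sup>* `` {v}"
proof -
  obtain a where a: "C = (adj F)\<^sup>* `` {a}" using C by (auto simp: graph_components_def quotient_def)
  then have av: "(a, v) \<in> (adj F)\<^sup>*" using v by simp
  then have "(v, a) \<in> (adj F)\<^sup>*" by (rule symD[OF sym_rtrancl[OF sym_adj]])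
  with av show ?thesis unfolding a by (auto intro: rtrancl_trans)
qed

lemma component_nonempty: "C \<in> graph_components V F \<Longrightarrow> C \<noteq> {}"
  by (auto simp: graph_components_def quotient_def)

lemma component_subset:
  assumes C: "C \<in> graph_components V F" and F: "F \<subseteq> Pow V"
  shows "C \<subseteq> V"
proof
  fix x assume x: "x \<in> C"
  obtain a where a: "C = (adj F)\<^sup>* `` {a}" "a \<in> V"
    using C by (auto simp: graph_components_def quotient_def)
  then have "(a, x) \<in> (adj F)\<^sup>*" using x by simp
  then show "x \<in> V" using a F by (induction) (auto simp: adj_def)
qed

lemma relpow_induced_edges:
  assumes "(v, x) \<in> adj F ^^ j" "v \<in> C" "\<And>y z. y \<in> C \<Longrightarrow> (y, z) \<in> adj F \<Longrightarrow> z \<in> C"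
  shows "(v, x) \<in> adj (induced_edges F C) ^^ j \<and> x \<in> C"
  using assms(1)
proof (induction j arbitrary: x)
  case 0
  then show ?case using assms by simp
next
  case (Suc j)
  then obtain y where y: "(v, y) \<in> adj F ^^ j" "(y, x) \<in> adj F" by auto
  with Suc.IH have IH: "(v, y) \<in> adj (induced_edges F C) ^^ j" "y \<in> C" by auto
  moreover have "x \<in> C" using assms(3) IH y by blast
  ultimately show ?case using y by (auto simp: adj_def induced_edges_def)
qed

lemma sym_relpow:
  assumes "sym r"
  shows "sym (r ^^ j)"
proof (induction j)
  case (Suc j)
  show ?case
  proof (rule symI)
    fix x z assume "(x, z) \<in> r ^^ Suc j"
    then obtain y where "(x, y) \<in> r ^^ j" "(y, z) \<in> r" by auto
    then have "(z, y) \<in> r" "(y, x) \<in> r ^^ j" using assms Suc by (auto dest: symD)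
    then show "(z, x) \<in> r ^^ Suc j" by (rule relpow_Suc_I2)
  qed
qed (simp add: sym_Id)

text \<open>If every vertex of the component were within distance \<open>r\<close> of \<open>v\<close>, concatenating two paths
  through \<open>v\<close> would bound the diameter by \<open>2 * r\<close>.\<close>
lemma survives_if_large_diam:
  assumes C: "C \<in> graph_components V F" and fin: "finite C" and v: "v \<in> C"
    and diam: "2 * r < component_diam F C"
  shows "survives F {v} (Suc r)"
proof (rule ccontr)
  assume not: "\<not> survives F {v} (Suc r)"
  let ?I = "induced_edges F C"
  have Cv: "C = (adj F)\<^sup>* `` {v}" by (rule component_eq_reach[OF C v])
  have walk: "\<exists>j\<le>r. (v, x) \<in> adj ?I ^^ j" if x: "x \<in> C" for x
  proof -
    obtain j where "j < Suc r" "(v, x) \<in> adj F ^^ j"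
      using survives_if_far[of x F "{v}" "Suc r"] not x Cv by auto
    moreover have "z \<in> C" if "y \<in> C" "(y, z) \<in> adj F" for y z
      using that unfolding Cv by auto
    ultimately show ?thesis using relpow_induced_edges[OF _ v] by (metis less_Suc_eq_le)
  qed
  have dist: "graph_dist ?I x y \<le> 2 * r" if xy: "x \<in> C" "y \<in> C" for x y
  proof -
    obtain i j where ij: "i \<le> r" "(v, x) \<in> adj ?I ^^ i" "j \<le> r" "(v, y) \<in> adj ?I ^^ j"
      using walk xy by meson
    from ij(2) have "(x, v) \<in> adj ?I ^^ i" by (rule symD[OF sym_relpow[OF sym_adj]])
    with ij have "(x, y) \<in> adj ?I ^^ (i + j)" by (auto simp: relpow_add)
    then have "graph_dist ?I x y \<le> i + j" unfolding graph_dist_def by (rule Least_le)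
    with ij show ?thesis by simp
  qed
  let ?Ds = "{graph_dist ?I x y | x y. x \<in> C \<and> y \<in> C}"
  have "?Ds = (\<lambda>(x, y). graph_dist ?I x y) ` (C \<times> C)" by auto
  then have "finite ?Ds" using fin by simp
  moreover have "?Ds \<noteq> {}" using v by auto
  ultimately have "Max ?Ds \<le> 2 * r" using dist by (intro Max.boundedI) auto
  then show False using diam by (simp add: component_diam_def graph_diam_def)
qed

section \<open>Independence of successive levels\<close>

lemma percolation_union:
  assumes "finite A" "finite B" "A \<inter> B = {}"
  shows "percolation (A \<union> B) p
    = map_pmf (\<lambda>(F, G). F \<union> G) (pair_pmf (percolation A p) (percolation B p))"
proof -
  have "percolation (A \<union> B) p = map_pmf (\<lambda>(f, g). {e \<in> A. f e} \<union> {e \<in> B. g e})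
     (pair_pmf (Pi_pmf A False (\<lambda>_. bernoulli_pmf p)) (Pi_pmf B False (\<lambda>_. bernoulli_pmf p)))"
    unfolding percolation_def Pi_pmf_union[OF assms] pmf.map_comp
    by (rule arg_cong2[where f=map_pmf]) (use assms(3) in \<open>auto simp: fun_eq_iff\<close>)
  also have "\<dots> = map_pmf (\<lambda>(F, G). F \<union> G) (pair_pmf (percolation A p) (percolation B p))"
    unfolding percolation_def map_pair[symmetric] pmf.map_comp
    by (rule arg_cong2[where f=map_pmf]) auto
  finally show ?thesis .
qed

lemma set_percolation: "set_pmf (percolation E p) \<subseteq> Pow E"
  by (auto simp: percolation_def)

text \<open>The probability generating function of the binomial distribution.\<close>
lemma expectation_power_card_percolation:
  assumes "finite E" "0 \<le> p" "p \<le> 1" "q \<le> 1"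
  shows "measure_pmf.expectation (percolation E p) (\<lambda>F. (1 - q) ^ card F) = (1 - p * q) ^ card E"
proof -
  have "measure_pmf.expectation (percolation E p) (\<lambda>F. (1 - q) ^ card F)
     = measure_pmf.expectation (Pi_pmf E False (\<lambda>_. bernoulli_pmf p))
         (\<lambda>f. \<Prod>e\<in>E. if f e then 1 - q else 1)"
    using assms(1) by (simp add: percolation_def prod.If_cases Int_def)
  also have "\<dots> = (\<Prod>e\<in>E. measure_pmf.expectation (bernoulli_pmf p) (\<lambda>b. if b then 1 - q else 1))"
    using assms by (subst expectation_prod_Pi_pmf) (auto intro: integrable_measure_pmf_finite)
  also have "\<dots> = (1 - p * q) ^ card E"
    using assms by (simp add: algebra_simps)
  finally show ?thesis .
qed

lemma prob_bind_pmf: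
  "measure_pmf.prob (bind_pmf M f) X = measure_pmf.expectation M (\<lambda>x. measure_pmf.prob (f x) X)"
proof -
  have "ennreal (measure_pmf.prob (bind_pmf M f) X) = (\<integral>\<^sup>+x. ennreal (measure_pmf.prob (f x) X) \<partial>M)"
    by (simp flip: measure_pmf.emeasure_eq_measure)
  also have "\<dots> = ennreal (measure_pmf.expectation M (\<lambda>x. measure_pmf.prob (f x) X))"
    by (intro nn_integral_eq_integral measure_pmf.integrable_const_bound[where B=1]) auto
  finally show ?thesis by simp
qed

text \<open>Each edge meeting \<open>S\<close> has at most one endpoint outside \<open>S\<close>.\<close>
lemma card_next_level_le:
  assumes "finite F" "\<And>e. e \<in> F \<Longrightarrow> card e = 2"
  shows "finite (next_level F S) \<and> card (next_level F S) \<le> card (touching F S)"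
proof -
  have fin: "finite (touching F S)" using assms by (auto simp: touching_def)
  have one: "finite (e - S) \<and> card (e - S) \<le> 1" if "e \<in> touching F S" for e
  proof -
    from that have e: "card e = 2" "e \<inter> S \<noteq> {}" using assms by (auto simp: touching_def)
    then have "finite e" using card.infinite by fastforce
    moreover have "e - S \<subset> e" using e by auto
    ultimately have "card (e - S) < card e" by (rule psubset_card_mono)
    with e \<open>finite e\<close> show ?thesis by simp
  qed
  have sub: "next_level F S \<subseteq> (\<Union>e\<in>touching F S. e - S)"
    by (auto simp: next_level_def touching_def)
  have finU: "finite (\<Union>e\<in>touching F S. e - S)"
    by (rule finite_UN_I[OF fin]) (use one in blast)
  have "card (next_level F S) \<le> card (\<Union>e\<in>touching F S. e - S)"
    by (rule card_mono[OF finU sub])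
  also have "\<dots> \<le> (\<Sum>e\<in>touching F S. card (e - S))" by (rule card_UN_le[OF fin])
  also have "\<dots> \<le> (\<Sum>e\<in>touching F S. 1)" using one by (intro sum_mono) auto
  finally show ?thesis using finite_subset[OF sub finU] by simp
qed

text \<open>The Markov property of the exploration, in the form of an inequality. The edges touching \<open>S\<close> are
  revealed; whatever the next level turns out to be, the remaining edges are fresh. Replacing
  the size of the next level by the number of retained edges is harmless because
  \<open>1 - (1 - q) ^ w\<close> increases in \<open>w\<close>, and after this replacement the mean is explicit.\<close>
lemma prob_next_level_le:
  assumes E: "finite E" "\<And>e. e \<in> E \<Longrightarrow> card e = 2"
    and p: "0 \<le> p" "p \<le> 1" and q: "0 \<le> q" "q \<le> 1" and c: "0 \<le> c"
    and H: "\<And>S'. S' \<subseteq> next_level E S \<Longrightarrow>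
      measure_pmf.prob (percolation (avoiding E S) p) {F. Q F S'} \<le> c * (1 - (1 - q) ^ card S')"
  shows "measure_pmf.prob (percolation E p) {F. Q (avoiding F S) (next_level F S)}
    \<le> c * (1 - (1 - p * q) ^ card (touching E S))"
proof -
  let ?T = "touching E S" and ?A = "avoiding E S"
  let ?X = "{F. Q (avoiding F S) (next_level F S)}"
  have E_eq: "E = ?T \<union> ?A" and disj: "?T \<inter> ?A = {}" and fin: "finite ?T" "finite ?A"
    using E by (auto simp: touching_def avoiding_def)
  have supp: "set_pmf (percolation ?T p) \<subseteq> Pow ?T" by (rule set_percolation)
  have finT: "finite (set_pmf (percolation ?T p))"
    using supp fin by (meson finite_Pow_iff finite_subset)
  have "percolation E p = bind_pmf (percolation ?T p) (\<lambda>F1. map_pmf (\<lambda>F2. F1 \<union> F2) (percolation ?A p))"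
    by (subst E_eq, subst percolation_union[OF fin disj])
       (simp add: pair_pmf_def map_pmf_def bind_return_pmf bind_assoc_pmf)
  then have "measure_pmf.prob (percolation E p) ?X = measure_pmf.expectation (percolation ?T p)
      (\<lambda>F1. measure_pmf.prob (percolation ?A p) {F2. F1 \<union> F2 \<in> ?X})"
    by (simp add: prob_bind_pmf vimage_def)
  also have "\<dots> \<le> measure_pmf.expectation (percolation ?T p) (\<lambda>F1. c * (1 - (1 - q) ^ card F1))"
  proof (intro integral_mono_AE AE_pmfI)
    fix F1 assume "F1 \<in> set_pmf (percolation ?T p)"
    with supp have F1: "F1 \<subseteq> ?T" by auto
    have "measure_pmf.prob (percolation ?A p) {F2. F1 \<union> F2 \<in> ?X}
        \<le> measure_pmf.prob (percolation ?A p) {F. Q F (next_level F1 S)}"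
    proof (intro measure_pmf.finite_measure_mono_AE AE_pmfI impI)
      fix F2 assume "F2 \<in> set_pmf (percolation ?A p)"
      with set_percolation have F2: "F2 \<subseteq> ?A" by auto
      have "avoiding (F1 \<union> F2) S = F2" using F1 F2 by (auto simp: avoiding_def touching_def)
      moreover have "next_level (F1 \<union> F2) S = next_level F1 S"
        using F2 by (auto simp: next_level_def avoiding_def)
      moreover assume "F2 \<in> {F2. F1 \<union> F2 \<in> ?X}"
      ultimately show "F2 \<in> {F. Q F (next_level F1 S)}" by simp
    qed auto
    also have "\<dots> \<le> c * (1 - (1 - q) ^ card (next_level F1 S))"
      using F1 by (intro H) (auto simp: next_level_def touching_def)
    also have "\<dots> \<le> c * (1 - (1 - q) ^ card F1)"
    proof -
      have "F1 \<subseteq> E" using F1 by (auto simp: touching_def)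
      then have "card (next_level F1 S) \<le> card (touching F1 S)"
        using card_next_level_le[of F1 S] E finite_subset by blast
      also have "\<dots> \<le> card F1"
        using finite_subset[OF F1 fin(1)] by (intro card_mono) (auto simp: touching_def)
      finally show ?thesis using q c by (intro mult_left_mono diff_left_mono power_decreasing) auto
    qed
    finally show "measure_pmf.prob (percolation ?A p) {F2. F1 \<union> F2 \<in> ?X} \<le> c * (1 - (1 - q) ^ card F1)" .
  qed (use finT in \<open>auto intro: integrable_measure_pmf_finite\<close>)
  also have "\<dots> = c * (1 - measure_pmf.expectation (percolation ?T p) (\<lambda>F1. (1 - q) ^ card F1))"
    using finT by (simp add: integrable_measure_pmf_finite)
  also have "\<dots> = c * (1 - (1 - p * q) ^ card ?T)"
    using fin p q by (simp add: expectation_power_card_percolation)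
  finally show ?thesis .
qed

text \<open>A state of the exploration, with \<open>w\<close> the size that the level counts for. In general
  \<open>w = card S\<close>, since each vertex of a later level has used up one of its edges. The root may have
  \<open>D + 1\<close> edges, so it counts as two vertices; the slack up to \<open>2 * card S\<close> leaves room for this.\<close>
definition bfs_front :: "nat \<Rightarrow> 'a set set \<Rightarrow> 'a set \<Rightarrow> nat \<Rightarrow> bool" where
  "bfs_front D E S w \<longleftrightarrow> finite E \<and> (\<forall>e\<in>E. card e = 2) \<and> (\<forall>v. vertex_degree E v \<le> Suc D) \<and>
     finite S \<and> card S \<le> w \<and> w \<le> 2 * card S \<and> card (touching E S) \<le> D * w"

lemma bfs_front_singleton:
  assumes "finite E" "\<And>e. e \<in> E \<Longrightarrow> card e = 2" "\<And>v. vertex_degree E v \<le> Suc D" "1 \<le> D"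
  shows "bfs_front D E {v} 2"
proof -
  have "touching E {v} = {e \<in> E. v \<in> e}" by (auto simp: touching_def)
  then have "card (touching E {v}) \<le> Suc D" using assms(3)[of v] by (simp add: vertex_degree_def)
  then show ?thesis using assms by (auto simp: bfs_front_def)
qed

text \<open>The edge through which a vertex was discovered touches \<open>S\<close> and is no longer available, so at
  most \<open>D\<close> edges remain at that vertex.\<close>
lemma bfs_front_next_level:
  assumes fr: "bfs_front D E S w" and S': "S' \<subseteq> next_level E S"
  shows "bfs_front D (avoiding E S) S' (card S')"
proof -
  let ?A = "avoiding E S"
  have E: "finite E" "\<And>e. e \<in> E \<Longrightarrow> card e = 2" and deg: "\<And>v. vertex_degree E v \<le> Suc D"
    using fr by (auto simp: bfs_front_def)
  have A: "?A \<subseteq> E" by (auto simp: avoiding_def)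
  then have finA: "finite ?A" using E finite_subset by blast
  have finS': "finite S'" using card_next_level_le[OF E] S' finite_subset by blast
  have degA: "vertex_degree ?A v \<le> Suc D" for v
  proof -
    have "vertex_degree ?A v \<le> vertex_degree E v"
      unfolding vertex_degree_def using A E by (intro card_mono) auto
    with deg[of v] show ?thesis by simp
  qed
  have child: "card {e \<in> ?A. u \<in> e} \<le> D" if u: "u \<in> S'" for u
  proof -
    obtain s where s: "s \<in> S" "{s, u} \<in> E" using subsetD[OF S' u] by (auto simp: next_level_def)
    have "{e \<in> ?A. u \<in> e} \<subseteq> {e \<in> E. u \<in> e}" using A by blast
    moreover have "{s, u} \<in> {e \<in> E. u \<in> e} - {e \<in> ?A. u \<in> e}" using s by (simp add: avoiding_def)
    ultimately have "{e \<in> ?A. u \<in> e} \<subset> {e \<in> E. u \<in> e}" by blast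
    then have "card {e \<in> ?A. u \<in> e} < card {e \<in> E. u \<in> e}"
      using E by (intro psubset_card_mono) auto
    then show ?thesis using deg[of u] by (simp add: vertex_degree_def)
  qed
  have "touching ?A S' = (\<Union>u\<in>S'. {e \<in> ?A. u \<in> e})" by (auto simp: touching_def)
  then have "card (touching ?A S') \<le> (\<Sum>u\<in>S'. card {e \<in> ?A. u \<in> e})"
    using card_UN_le[OF finS'] by simp
  also have "\<dots> \<le> (\<Sum>u\<in>S'. D)" using child by (intro sum_mono)
  finally have "card (touching ?A S') \<le> D * card S'" by (simp add: mult.commute)
  then show ?thesis using finA finS' degA A E by (auto simp: bfs_front_def)
qed

lemma bfs_front_prob_step:
  assumes fr: "bfs_front D E S w" and D: "2 \<le> D"
    and p: "0 \<le> p" "p \<le> 1" and q: "0 \<le> q" "q \<le> 1" and pD: "p * real D \<le> 1 + q / 8"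
    and c: "0 \<le> c"
    and H: "\<And>S'. S' \<subseteq> next_level E S \<Longrightarrow>
      measure_pmf.prob (percolation (avoiding E S) p) {F. Q F S'} \<le> c * (1 - (1 - q) ^ card S')"
  shows "measure_pmf.prob (percolation E p) {F. Q (avoiding F S) (next_level F S)}
    \<le> c * (1 - (1 - (q - q\<^sup>2 / 8)) ^ w)"
proof -
  have E: "finite E" "\<And>e. e \<in> E \<Longrightarrow> card e = 2" using fr by (auto simp: bfs_front_def)
  have pq: "0 \<le> p * q" "p * q \<le> 1" using p q by (auto intro: mult_le_one)
  have "q\<^sup>2 / 8 \<ge> 0" by simp
  then have "(1 - (q - q\<^sup>2 / 8)) ^ w \<le> ((1 - p * q) ^ D) ^ w"
    using offspring_survival_contracts[OF p q D pD] q by (intro power_mono) linarith+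
  also have "\<dots> = (1 - p * q) ^ (D * w)" by (simp add: power_mult)
  also have "\<dots> \<le> (1 - p * q) ^ card (touching E S)"
    using fr pq by (intro power_decreasing) (auto simp: bfs_front_def)
  finally have "c * (1 - (1 - p * q) ^ card (touching E S)) \<le> c * (1 - (1 - (q - q\<^sup>2 / 8)) ^ w)"
    using c by (intro mult_left_mono) auto
  with prob_next_level_le[OF E p q c H] show ?thesis by (rule order_trans)
qed

section \<open>Survival probabilities\<close>

text \<open>The sequence \<open>8 / (k + 8)\<close> starts at 1, the trivial bound, and decreases no faster than the
  recursion that maps \<open>a\<close> to \<open>a - a\<^sup>2 / 8\<close>. The recursion is available as long as \<open>a \<ge> q\<close>.\<close>
lemma prob_survives_le_max:
  assumes D: "2 \<le> D" and p: "0 \<le> p" "p \<le> 1" and q: "0 \<le> q" "q \<le> 1"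
    and pD: "p * real D \<le> 1 + q / 8" and fr: "bfs_front D E S w"
  shows "measure_pmf.prob (percolation E p) {F. survives F S k}
    \<le> 1 - (1 - max q (8 / (real k + 8))) ^ w"
  using fr
proof (induction k arbitrary: E S w)
  case 0
  show ?case
  proof (cases "S = {}")
    case False
    then have "0 < w" using 0 by (auto simp: bfs_front_def card_gt_0_iff)
    then show ?thesis using q False by (simp add: max_def power_0_left)
  next
    case True
    then show ?thesis using q by (simp add: max_def power_0_left)
  qed
next
  case (Suc k)
  define a where "a = max q (8 / (real k + 8))"
  define b where "b = max q (8 / (real (Suc k) + 8))"
  have a: "0 \<le> a" "a \<le> 1" "q \<le> a" using q by (auto simp: a_def divide_simps)
  have "a - a\<^sup>2 / 8 \<le> b"
  proof (cases "q \<le> 8 / (real k + 8)")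
    case True
    then have a_eq: "a = 8 / (real k + 8)" by (simp add: a_def)
    have "a - a\<^sup>2 / 8 = 8 * (real k + 7) / (real k + 8)\<^sup>2"
      unfolding a_eq by (simp add: divide_simps power2_eq_square)
    also have "\<dots> \<le> 8 / (real (Suc k) + 8)"
      by (simp add: divide_simps power2_eq_square) (simp add: algebra_simps)
    finally show ?thesis by (simp add: b_def)
  next
    case False
    then have "a - a\<^sup>2 / 8 \<le> q" by (simp add: a_def)
    then show ?thesis by (simp add: b_def)
  qed
  have "b \<le> 1" using q by (auto simp: b_def divide_simps)
  have "measure_pmf.prob (percolation E p) {F. survives F S (Suc k)} \<le> 1 * (1 - (1 - (a - a\<^sup>2 / 8)) ^ w)"
    unfolding survives.simps
  proof (rule bfs_front_prob_step[OF Suc.prems D p a(1,2)])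
    fix S' assume "S' \<subseteq> next_level E S"
    then show "measure_pmf.prob (percolation (avoiding E S) p) {F. survives F S' k} \<le> 1 * (1 - (1 - a) ^ card S')"
      using Suc.IH[OF bfs_front_next_level[OF Suc.prems]] by (simp add: a_def)
  qed (use pD a in auto)
  also have "\<dots> \<le> 1 - (1 - b) ^ w"
    using \<open>a - a\<^sup>2 / 8 \<le> b\<close> \<open>b \<le> 1\<close> by (simp add: power_mono)
  finally show ?case by (simp add: b_def)
qed

text \<open>After \<open>k0\<close> levels the survival bound has come down to parameter \<open>q\<close>. The other \<open>j\<close> levels, which the
  recursion peels off first, gain the factor of \<open>survival_drift\<close> each. Its cost is charged to the
  budget \<open>b\<close>, of which a level consumes \<open>card S \<ge> w / 2\<close>; this is where \<open>q\<^sup>2 / 4\<close> comes from. The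
  budget is a real number because it may become negative.\<close>
lemma prob_survives_small_le:
  assumes D: "2 \<le> D" and p: "0 \<le> p" "p \<le> 1" and q: "0 < q" "q \<le> 1"
    and pD: "p * real D \<le> 1 + q / 8" and k0: "8 / q \<le> real k0" and fr: "bfs_front D E S w"
  shows "measure_pmf.prob (percolation E p) {F. survives F S (k0 + j) \<and> real (explored F S (k0 + j)) \<le> b}
    \<le> (1 - (1 - q) ^ w) * exp (- q / 8 * real j + q\<^sup>2 / 4 * b)"
  using fr
proof (induction j arbitrary: E S w b)
  case 0
  have nn: "0 \<le> 1 - (1 - q) ^ w" using q by (simp add: power_le_one)
  show ?case
  proof (cases "b < 0")
    case True
    then have empty: "{F. survives F S (k0 + 0) \<and> real (explored F S (k0 + 0)) \<le> b} = {}"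
      by auto
    show ?thesis unfolding empty using nn by simp
  next
    case False
    have "8 / (real k0 + 8) \<le> q" using k0 q by (simp add: field_simps)
    then have m: "max q (8 / (real k0 + 8)) = q" by simp
    have "measure_pmf.prob (percolation E p) {F. survives F S (k0 + 0) \<and> real (explored F S (k0 + 0)) \<le> b}
      \<le> measure_pmf.prob (percolation E p) {F. survives F S k0}"
      by (intro measure_pmf.finite_measure_mono) auto
    also have "\<dots> \<le> 1 - (1 - q) ^ w"
      using prob_survives_le_max[OF D p less_imp_le[OF q(1)] q(2) pD 0, of k0] m by simp
    also have "\<dots> \<le> (1 - (1 - q) ^ w) * exp (- q / 8 * real 0 + q\<^sup>2 / 4 * b)"
      using False nn by (simp add: mult_le_cancel_left1)
    finally show ?thesis .
  qed
next
  case (Suc j)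
  define B where "B = b - real (card S)"
  define c where "c = exp (- q / 8 * real j + q\<^sup>2 / 4 * B)"
  have w: "w \<le> 2 * card S" using Suc.prems by (simp add: bfs_front_def)
  have nn: "0 \<le> 1 - (1 - q) ^ w" using q by (simp add: power_le_one)
  have "{F. survives F S (k0 + Suc j) \<and> real (explored F S (k0 + Suc j)) \<le> b} =
    {F. survives (avoiding F S) (next_level F S) (k0 + j)
      \<and> real (explored (avoiding F S) (next_level F S) (k0 + j)) \<le> B}"
    by (auto simp: B_def)
  then have "measure_pmf.prob (percolation E p) {F. survives F S (k0 + Suc j) \<and> real (explored F S (k0 + Suc j)) \<le> b}
     \<le> c * (1 - (1 - (q - q\<^sup>2 / 8)) ^ w)"
  proof (simp only:, intro bfs_front_prob_step[OF Suc.prems D p _ _ pD])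
    fix S' assume "S' \<subseteq> next_level E S"
    from Suc.IH[OF bfs_front_next_level[OF Suc.prems this], of B]
    show "measure_pmf.prob (percolation (avoiding E S) p)
        {F. survives F S' (k0 + j) \<and> real (explored F S' (k0 + j)) \<le> B} \<le> c * (1 - (1 - q) ^ card S')"
      by (simp add: c_def mult.commute)
  qed (use q in \<open>auto simp: c_def\<close>)
  also have "\<dots> \<le> c * ((1 - (1 - q) ^ w) * exp (- q / 8 + q\<^sup>2 / 8 * real w))"
    using q by (intro mult_left_mono survival_drift) (auto simp: c_def)
  also have "\<dots> \<le> c * ((1 - (1 - q) ^ w) * exp (- q / 8 + q\<^sup>2 / 4 * real (card S)))"
  proof -
    have "real w \<le> 2 * real (card S)" using w by linarith
    then have "q\<^sup>2 / 8 * real w \<le> q\<^sup>2 / 8 * (2 * real (card S))"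
      by (rule mult_left_mono) simp
    then have "exp (- q / 8 + q\<^sup>2 / 8 * real w) \<le> exp (- q / 8 + q\<^sup>2 / 4 * real (card S))"
      by (simp add: mult_ac)
    moreover have "0 \<le> c" by (simp add: c_def)
    ultimately show ?thesis using nn by (intro mult_left_mono)
  qed
  also have "\<dots> = (1 - (1 - q) ^ w) * exp (- q / 8 * real (Suc j) + q\<^sup>2 / 4 * b)"
  proof -
    have "c * exp (- q / 8 + q\<^sup>2 / 4 * real (card S)) = exp (- q / 8 * real (Suc j) + q\<^sup>2 / 4 * b)"
      unfolding c_def B_def exp_add[symmetric] by (rule arg_cong[where f=exp]) (simp add: field_simps)
    then show ?thesis by (metis mult.left_commute)
  qed
  finally show ?case .
qed

text \<open>The exponent \<open>- q * r / 8 + q\<^sup>2 * M / 4\<close> of the previous bound is smallest at \<open>q = r / (4 * M)\<close>.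
  The factor \<open>r / M\<close> in front is essential: it turns the sum over starting vertices into
  a power of \<open>n / M powr (3/2)\<close>.\<close>
lemma prob_survives_singleton_le:
  assumes D: "2 \<le> D" and p: "0 \<le> p" "p \<le> 1" and M: "0 < M"
    and r: "64 * M \<le> (real r)\<^sup>2" and pD: "p * real D \<le> 1 + real r / (32 * M)"
    and E: "finite E" "\<And>e. e \<in> E \<Longrightarrow> card e = 2" "\<And>v. vertex_degree E v \<le> Suc D"
  shows "measure_pmf.prob (percolation E p) {F. survives F {v} r \<and> real (explored F {v} r) \<le> M}
    \<le> 2 * (real r / M) * exp (- (real r)\<^sup>2 / (64 * M))" (is "?P \<le> ?b")
proof (cases "real r < M")
  case False
  \<comment> \<open>Surviving \<open>r\<close> levels means \<open>r + 1\<close> nonempty levels, too many vertices for the budget \<open>M\<close>.\<close>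
  have "?P \<le> measure_pmf.prob (percolation E p) {}"
  proof (intro measure_pmf.finite_measure_mono_AE AE_pmfI impI)
    fix F assume "F \<in> set_pmf (percolation E p)"
    with set_percolation have F: "F \<subseteq> E" by auto
    assume "F \<in> {F. survives F {v} r \<and> real (explored F {v} r) \<le> M}"
    moreover from this have "Suc r \<le> explored F {v} r"
      using F E finite_subset by (intro Suc_le_explored) auto
    ultimately show "F \<in> {}" using False by simp
  qed auto
  also have "\<dots> \<le> ?b" using M by simp
  finally show ?thesis .
next
  case True
  have r0: "0 < real r" using r M by (cases "r = 0") auto
  have "64 * real r \<le> real r * real r" using r True by (simp add: power2_eq_square)
  then have r64: "64 \<le> real r" using r0 by simp
  define q where "q = real r / (4 * M)"
  define k where "k = nat \<lceil>8 / q\<rceil>"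
  have q: "0 < q" "q \<le> 1" using True r0 M by (auto simp: q_def)
  have k: "8 / q \<le> real k" "real k \<le> 8 / q + 1"
    using q by (auto simp: k_def real_nat_ceiling_ge)
  have "8 / q \<le> real r / 2" using r M r0 by (simp add: q_def field_simps power2_eq_square)
  then have kr: "k \<le> r" using k r64 by linarith
  have qk: "q * real k \<le> 9"
  proof -
    have "q * real k \<le> q * (8 / q + 1)" using k q by (intro mult_left_mono) auto
    also have "\<dots> = 8 + q" using q by (simp add: distrib_left)
    finally show ?thesis using q by simp
  qed
  have front: "bfs_front D E {v} 2" using E D by (intro bfs_front_singleton) auto
  have "p * real D \<le> 1 + q / 8" using pD by (simp add: q_def)
  from prob_survives_small_le[OF D p q this k(1) front, of "r - k" M]
  have "?P \<le> (1 - (1 - q)\<^sup>2) * exp (- q / 8 * real (r - k) + q\<^sup>2 / 4 * M)"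
    using kr by simp
  also have "\<dots> \<le> 2 * q * exp (9 / 8 + - (real r)\<^sup>2 / (64 * M))"
  proof (intro mult_mono)
    have "- q / 8 * real (r - k) + q\<^sup>2 / 4 * M = q * real k / 8 + (- q / 8 * real r + q\<^sup>2 / 4 * M)"
      using kr by (simp add: of_nat_diff field_simps)
    also have "- q / 8 * real r + q\<^sup>2 / 4 * M = - (real r)\<^sup>2 / (64 * M)"
      using M by (simp add: q_def field_simps power2_eq_square)
    finally show "exp (- q / 8 * real (r - k) + q\<^sup>2 / 4 * M) \<le> exp (9 / 8 + - (real r)\<^sup>2 / (64 * M))"
      using qk by simp
  qed (use q in \<open>auto simp: power2_eq_square algebra_simps\<close>)
  also have "\<dots> = 2 * q * exp (9 / 8) * exp (- (real r)\<^sup>2 / (64 * M))"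
    by (simp only: exp_add mult.assoc)
  also have "\<dots> \<le> 2 * q * 4 * exp (- (real r)\<^sup>2 / (64 * M))"
  proof -
    have "1 + - (1/8) \<le> exp (- (1/8) :: real)" by (rule exp_ge_add_one_self)
    then have "exp (1/8 :: real) \<le> 8 / 7" by (simp add: exp_minus field_simps)
    then have "exp 1 * exp (1/8 :: real) \<le> 3 * (8 / 7)" using exp_le by (intro mult_mono) auto
    then have "exp (9/8 :: real) \<le> 4" by (simp add: mult_exp_exp)
    then show ?thesis using q by (intro mult_right_mono mult_left_mono) auto
  qed
  also have "\<dots> = ?b" using M by (simp add: q_def)
  finally show ?thesis .
qed

section \<open>From vertices to components\<close>

text \<open>Markov's inequality for the number of vertices \<open>v\<close> whose event \<open>X v\<close> occurs.\<close>
lemma prob_le_sum_over_vertices: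
  fixes P :: "'b pmf" and X :: "'a \<Rightarrow> 'b set"
  assumes V: "finite V" and c: "0 < c"
    and many: "\<And>F. F \<in> set_pmf P \<Longrightarrow> F \<in> Z \<Longrightarrow> c \<le> real (card {v \<in> V. F \<in> X v})"
  shows "measure_pmf.prob P Z \<le> (\<Sum>v\<in>V. measure_pmf.prob P (X v)) / c"
proof -
  have "c * measure_pmf.prob P Z = measure_pmf.expectation P (\<lambda>F. c * indicator Z F)" by simp
  also have "\<dots> \<le> measure_pmf.expectation P (\<lambda>F. \<Sum>v\<in>V. indicator (X v) F)"
  proof (intro integral_mono_AE AE_pmfI)
    fix F assume F: "F \<in> set_pmf P"
    have "(\<Sum>v\<in>V. indicator (X v) F) = real (card {v \<in> V. F \<in> X v})"
      using V by (simp add: indicator_def sum.If_cases Int_def)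
    then show "c * indicator Z F \<le> (\<Sum>v\<in>V. indicator (X v) F)"
      using many[OF F] by (auto simp: indicator_def)
  qed (auto intro!: measure_pmf.integrable_const_bound[where B=c] measure_pmf.integrable_const_bound[where B=1]
      Bochner_Integration.integrable_sum simp: indicator_def c less_imp_le)
  also have "\<dots> = (\<Sum>v\<in>V. measure_pmf.prob P (X v))"
    by (subst Bochner_Integration.integral_sum) (auto intro: measure_pmf.integrable_const_bound[where B=1])
  finally show ?thesis using c by (simp add: pos_le_divide_eq mult.commute)
qed

lemma simple_graph_facts:
  assumes "simple_graph V E" "\<forall>v\<in>V. vertex_degree E v \<le> d"
  shows "finite V" "finite E" "E \<subseteq> Pow V" "\<And>e. e \<in> E \<Longrightarrow> card e = 2" "\<And>v. vertex_degree E v \<le> d"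
proof -
  show V: "finite V" "E \<subseteq> Pow V" "\<And>e. e \<in> E \<Longrightarrow> card e = 2"
    using assms by (auto simp: simple_graph_def)
  then show "finite E" using finite_subset by blast
  show "vertex_degree E v \<le> d" for v
  proof (cases "v \<in> V")
    case False
    then have none: "{e \<in> E. v \<in> e} = {}" using V by auto
    show ?thesis unfolding vertex_degree_def none by simp
  qed (use assms in auto)
qed

lemma component_vertices_survive:
  assumes G: "simple_graph V E" and F: "F \<in> set_pmf (percolation E p)"
    and C: "C \<in> graph_components V F" and R: "0 \<le> R" "R < real (component_diam F C)"
    and v: "v \<in> C"
  shows "survives F {v} (Suc (nat \<lfloor>R / 2\<rfloor>))" "explored F {v} k \<le> card C" "v \<in> V"
    "finite C" "card C > 0"
proof -
  have F': "F \<subseteq> Pow V" using F set_percolation[of E p] G by (auto simp: simple_graph_def)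
  have V: "finite V" using G by (simp add: simple_graph_def)
  have CV: "C \<subseteq> V" by (rule component_subset[OF C F'])
  then show fin: "finite C" using V finite_subset by blast
  show "v \<in> V" using v CV by auto
  show "card C > 0" using v fin by (auto simp: card_gt_0_iff)
  have "2 * nat \<lfloor>R / 2\<rfloor> < component_diam F C" using R by linarith
  then show "survives F {v} (Suc (nat \<lfloor>R / 2\<rfloor>))" by (rule survives_if_large_diam[OF C fin v])
  show "explored F {v} k \<le> card C"
    using explored_le_card_reach[of F "{v}" k] fin component_eq_reach[OF C v] by simp
qed

text \<open>Every vertex of a component with the stated properties is itself a witness for long survival
  with a small exploration, so one such component produces at least \<open>m\<close> witnesses.\<close>
lemma prob_components_between_le:
  assumes G: "simple_graph V E" and m: "0 < m" and R: "0 \<le> R" and r: "r = Suc (nat \<lfloor>R / 2\<rfloor>)"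
    and b: "\<And>v. v \<in> V \<Longrightarrow> measure_pmf.prob (percolation E p)
       {F. survives F {v} r \<and> real (explored F {v} r) \<le> M} \<le> b"
  shows "measure_pmf.prob (percolation E p)
     {F. \<exists>C\<in>graph_components V F. m \<le> real (card C) \<and> real (card C) \<le> M \<and> R < real (component_diam F C)}
    \<le> real (card V) * b / m"
proof -
  let ?X = "\<lambda>v. {F. survives F {v} r \<and> real (explored F {v} r) \<le> M}"
  have V: "finite V" using G by (simp add: simple_graph_def)
  have "measure_pmf.prob (percolation E p)
     {F. \<exists>C\<in>graph_components V F. m \<le> real (card C) \<and> real (card C) \<le> M \<and> R < real (component_diam F C)}
    \<le> (\<Sum>v\<in>V. measure_pmf.prob (percolation E p) (?X v)) / m"
  proof (rule prob_le_sum_over_vertices[OF V m])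
    fix F assume F: "F \<in> set_pmf (percolation E p)"
    assume "F \<in> {F. \<exists>C\<in>graph_components V F. m \<le> real (card C) \<and> real (card C) \<le> M
      \<and> R < real (component_diam F C)}"
    then obtain C where C: "C \<in> graph_components V F" and size: "m \<le> real (card C)" "real (card C) \<le> M"
      and diam: "R < real (component_diam F C)" by auto
    note facts = component_vertices_survive[OF G F C R diam, folded r]
    have "C \<subseteq> {v \<in> V. F \<in> ?X v}"
    proof
      fix v assume v: "v \<in> C"
      have "real (explored F {v} r) \<le> M" using facts(2)[OF v, of r] size by linarith
      then show "v \<in> {v \<in> V. F \<in> ?X v}" using facts(1,3)[OF v] by simp
    qed
    then have "card C \<le> card {v \<in> V. F \<in> ?X v}" using V by (intro card_mono) auto
    with size show "m \<le> real (card {v \<in> V. F \<in> ?X v})" by linarith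
  qed
  also have "\<dots> \<le> (\<Sum>v\<in>V. b) / m" using b m by (intro divide_right_mono sum_mono) auto
  finally show ?thesis by simp
qed

text \<open>Dyadic decomposition of the component size. The bound for sizes below \<open>M / 2\<close> is the bound for
  \<open>M\<close> times \<open>4 exp (- r\<^sup>2 / (64 M))\<close>, which is at most \<open>1 / 2\<close> when \<open>r\<^sup>2 \<ge> 192 M\<close>. The series
  over the scales is therefore dominated by its first term, and induction replaces the summation.
  It ends because a component has at least one vertex.\<close>
lemma prob_small_components_aux:
  assumes G: "simple_graph V E" and deg: "\<forall>v\<in>V. vertex_degree E v \<le> d" and d: "3 \<le> d"
    and p: "0 \<le> p" "p \<le> 1" and R: "0 \<le> R" and r: "r = Suc (nat \<lfloor>R / 2\<rfloor>)"
    and M: "0 < M" "M < 2 ^ k" and rM: "192 * M \<le> (real r)\<^sup>2"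
    and pd: "p * (real d - 1) \<le> 1 + real r / (32 * M)"
  shows "measure_pmf.prob (percolation E p)
     {F. \<exists>C\<in>graph_components V F. real (card C) < M \<and> R < real (component_diam F C)}
    \<le> 8 * real (card V) * real r / M\<^sup>2 * exp (- (real r)\<^sup>2 / (64 * M))"
  using M rM pd
proof (induction k arbitrary: M)
  case 0
  have "measure_pmf.prob (percolation E p)
     {F. \<exists>C\<in>graph_components V F. real (card C) < M \<and> R < real (component_diam F C)}
    \<le> measure_pmf.prob (percolation E p) {}"
  proof (intro measure_pmf.finite_measure_mono_AE AE_pmfI impI)
    fix F assume F: "F \<in> set_pmf (percolation E p)"
    assume "F \<in> {F. \<exists>C\<in>graph_components V F. real (card C) < M \<and> R < real (component_diam F C)}"
    then obtain C where C: "C \<in> graph_components V F" "real (card C) < M" "R < real (component_diam F C)"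
      by auto
    obtain v where "v \<in> C" using component_nonempty[OF C(1)] by auto
    then have "card C > 0" using component_vertices_survive(5)[OF G F C(1) R C(3)] by simp
    then show "F \<in> {}" using C(2) 0 by simp
  qed auto
  also have "\<dots> \<le> 8 * real (card V) * real r / M\<^sup>2 * exp (- (real r)\<^sup>2 / (64 * M))" by simp
  finally show ?case .
next
  case (Suc k)
  define x where "x = (real r)\<^sup>2 / (64 * M)"
  define f where "f = 8 * real (card V) * real r / M\<^sup>2 * exp (- x)"
  have f0: "0 \<le> f" by (simp add: f_def)
  let ?small = "\<lambda>M. {F. \<exists>C\<in>graph_components V F. real (card C) < M \<and> R < real (component_diam F C)}"
  let ?mid = "{F. \<exists>C\<in>graph_components V F. M / 2 \<le> real (card C) \<and> real (card C) \<le> M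
    \<and> R < real (component_diam F C)}"
  have half_pd: "p * (real d - 1) \<le> 1 + real r / (32 * (M / 2))"
  proof -
    have "real r / (32 * M) \<le> real r / (32 * (M / 2))" using Suc.prems by (intro divide_left_mono) auto
    with Suc.prems show ?thesis by linarith
  qed
  have mid: "measure_pmf.prob (percolation E p) ?mid \<le> f / 2"
  proof -
    have "measure_pmf.prob (percolation E p) ?mid
      \<le> real (card V) * (2 * (real r / M) * exp (- (real r)\<^sup>2 / (64 * M))) / (M / 2)"
    proof (rule prob_components_between_le[OF G _ R r])
      fix v assume "v \<in> V"
      have D: "real (d - 1) = real d - 1" using d by (simp add: of_nat_diff)
      have "Suc (d - 1) = d" using d by simp
      then show "measure_pmf.prob (percolation E p) {F. survives F {v} r \<and> real (explored F {v} r) \<le> M}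
        \<le> 2 * (real r / M) * exp (- (real r)\<^sup>2 / (64 * M))"
        using Suc.prems d simple_graph_facts[OF G deg]
        by (intro prob_survives_singleton_le[where D="d - 1"] p) (auto simp: D)
    qed (use Suc.prems in auto)
    also have "\<dots> = f / 2" using Suc.prems by (simp add: f_def x_def power2_eq_square)
    finally show ?thesis .
  qed
  have half: "measure_pmf.prob (percolation E p) (?small (M / 2)) \<le> f / 2"
  proof -
    have "measure_pmf.prob (percolation E p) (?small (M / 2))
      \<le> 8 * real (card V) * real r / (M / 2)\<^sup>2 * exp (- (real r)\<^sup>2 / (64 * (M / 2)))"
      using Suc.prems half_pd by (intro Suc.IH) auto
    also have "- (real r)\<^sup>2 / (64 * (M / 2)) = - x + - x" by (simp add: x_def)
    also have "8 * real (card V) * real r / (M / 2)\<^sup>2 * exp (- x + - x) = f * (4 * exp (- x))"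
      unfolding exp_add by (simp add: f_def power_divide)
    also have "\<dots> \<le> f * (1 / 2)"
    proof (intro mult_left_mono f0)
      have "3 \<le> x" using Suc.prems by (simp add: x_def field_simps)
      have "(2::real) ^ 3 \<le> exp 1 ^ 3" using exp_ge_add_one_self[of 1] by (intro power_mono) auto
      also have "\<dots> = exp 3" by (simp flip: exp_of_nat_mult)
      also have "\<dots> \<le> exp x" using \<open>3 \<le> x\<close> by simp
      finally show "4 * exp (- x) \<le> 1 / 2" by (simp add: exp_minus field_simps)
    qed
    finally show ?thesis by simp
  qed
  have "measure_pmf.prob (percolation E p) (?small M)
     \<le> measure_pmf.prob (percolation E p) (?mid \<union> ?small (M / 2))"
    by (intro measure_pmf.finite_measure_mono) force+
  also have "\<dots> \<le> measure_pmf.prob (percolation E p) ?mid + measure_pmf.prob (percolation E p) (?small (M / 2))"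
    by (intro measure_Un_le) auto
  also have "\<dots> \<le> f" using mid half by linarith
  finally show ?case by (simp add: f_def x_def)
qed

text \<open>The same bound in scale-invariant form: with \<open>y = r / sqrt M\<close> the prefactor \<open>r / M\<^sup>2\<close> equals
  \<open>y / M powr (3/2)\<close>, and half of the Gaussian exponent absorbs \<open>y\<close>.\<close>
lemma prob_small_components_le:
  assumes G: "simple_graph V E" and deg: "\<forall>v\<in>V. vertex_degree E v \<le> d" and d: "3 \<le> d"
    and p: "0 \<le> p" "p \<le> 1" and R: "0 \<le> R" and M: "0 < M" and RM: "768 * M \<le> R\<^sup>2"
    and pd: "p * (real d - 1) \<le> 1 + R / (64 * M)"
  shows "measure_pmf.prob (percolation E p)
     {F. \<exists>C\<in>graph_components V F. real (card C) < M \<and> real (component_diam F C) > R}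
    \<le> 48 * (real (card V) / M powr (3/2)) * exp (- R\<^sup>2 / (512 * M))"
proof -
  define r where "r = Suc (nat \<lfloor>R / 2\<rfloor>)"
  have r: "R / 2 \<le> real r" using R by (simp add: r_def) linarith
  then have "(R / 2)\<^sup>2 \<le> (real r)\<^sup>2" using R by (intro power_mono) auto
  then have r2: "R\<^sup>2 / 4 \<le> (real r)\<^sup>2" by (simp add: power_divide)
  obtain k where k: "M < 2 ^ k" using real_arch_pow[of 2 M] by auto
  have "R / (64 * M) \<le> real r / (32 * M)" using r M by (simp add: field_simps)
  then have *: "measure_pmf.prob (percolation E p)
     {F. \<exists>C\<in>graph_components V F. real (card C) < M \<and> R < real (component_diam F C)}
    \<le> 8 * real (card V) * real r / M\<^sup>2 * exp (- (real r)\<^sup>2 / (64 * M))"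
    using pd r2 RM by (intro prob_small_components_aux[OF G deg d p R r_def M k]) auto
  define y z where "y = real r / sqrt M" and "z = y\<^sup>2 / 128"
  have z: "z = (real r)\<^sup>2 / (128 * M)" using M by (simp add: z_def y_def power_divide)
  have M32: "M powr (3/2) * sqrt M = M\<^sup>2"
    using M by (simp add: powr_half_sqrt[symmetric] powr_add[symmetric])
  have "y \<le> 6 * exp z"
  proof -
    \<comment> \<open>The discriminant of \<open>1 + y\<^sup>2 / 128 - y / 6\<close> is negative; its minimum is at \<open>y = 32 / 3\<close>.\<close>
    have "0 \<le> (y - 32 / 3)\<^sup>2" by simp
    then have "y / 6 \<le> 1 + z" by (simp add: z_def power2_eq_square field_simps)
    then show ?thesis using exp_ge_add_one_self[of z] by linarith
  qed
  then have y6: "y * exp (- z) \<le> 6" by (simp add: exp_minus field_simps)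
  have "8 * real (card V) * real r / M\<^sup>2 * exp (- (real r)\<^sup>2 / (64 * M))
    = 8 * (real (card V) / M powr (3/2)) * (y * exp (- z)) * exp (- z)"
  proof -
    have "- (real r)\<^sup>2 / (64 * M) = - z + - z" by (simp add: z)
    then have "exp (- (real r)\<^sup>2 / (64 * M)) = exp (- z) * exp (- z)" by (simp only: exp_add)
    then show ?thesis unfolding M32[symmetric] y_def by simp
  qed
  also have "\<dots> \<le> 8 * (real (card V) / M powr (3/2)) * 6 * exp (- R\<^sup>2 / (512 * M))"
  proof (intro mult_mono)
    show "exp (- z) \<le> exp (- R\<^sup>2 / (512 * M))" using r2 M by (simp add: z field_simps)
    show "0 \<le> 8 * (real (card V) / M powr (3/2)) * 6" by simp
  qed (use y6 M in \<open>auto simp: y_def\<close>)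
  finally show ?thesis using * by simp
qed

section \<open>Diameters in the critical window\<close>

text \<open>With \<open>L = ln (n / M powr (3/2)) \<ge> 1\<close> and \<open>R = D2 * sqrt (M * L)\<close>, the previous bound reads
  \<open>48 exp (L - D2\<^sup>2 L / 512)\<close>, so a large \<open>D2\<close> yields any power of \<open>exp (- L)\<close>. Since
  \<open>M < n powr (2/3)\<close>, the window \<open>lam * n powr (-1/3)\<close> is at most a constant times
  \<open>1 / sqrt M\<close>, and a large \<open>D2\<close> makes \<open>R / (64 M)\<close> exceed it as well.\<close>
lemma diameter_tail_probability_bound:
  fixes lam D1 D2 M p :: real
  assumes G: "simple_graph V E" "card V = n" and deg: "\<forall>v\<in>V. vertex_degree E v \<le> d"
    and d: "3 \<le> d" "d \<le> n - 1" and p: "0 < p" "p < 1"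
    and pd: "p \<le> (1 + lam * real n powr (-1/3)) / (real d - 1)"
    and D1: "0 < D1" and D2: "D2 = 64 * (1 + \<bar>lam\<bar> + D1)"
    and M: "0 < M" "M < real n powr (2/3) / 2"
  shows "measure_pmf.prob (percolation E p)
     {F. \<exists>C\<in>graph_components V F. real (card C) < M \<and>
         real (component_diam F C) > D2 * sqrt (M * ln (real n / M powr (3/2)))}
    \<le> (M powr (3/2) / real n) powr D1"
proof -
  define t where "t = real n powr (1/3)"
  define L where "L = ln (real n / M powr (3/2))"
  define R where "R = D2 * sqrt (M * L)"
  have n: "0 < real n" using d by simp
  then have t: "0 < t" "real n powr (2/3) = t\<^sup>2" "real n powr (-1/3) = 1 / t" "real n = t ^ 3"
    by (auto simp: t_def powr_powr powr_minus_divide simp flip: powr_realpow)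
  have M32: "0 < M powr (3/2)" using M by simp
  have expL: "exp L = real n / M powr (3/2)" using n M32 by (simp add: L_def)
  have L1: "1 \<le> L"
  proof -
    have "exp 1 \<le> (2::real) powr (3/2)"
    proof -
      have "(14/10::real)\<^sup>2 \<le> 2" by (simp add: power2_eq_square)
      then have "14/10 \<le> sqrt (2::real)" by (rule real_le_rsqrt)
      then have "28/10 \<le> 2 * sqrt (2::real)" by simp
      also have "\<dots> = 2 powr 1 * 2 powr (1/2)" by (simp add: powr_half_sqrt)
      also have "\<dots> = (2::real) powr (3/2)" unfolding powr_add[symmetric] by simp
      finally show ?thesis using e_less_272 by linarith
    qed
    \<comment> \<open>Here the factor 1/2 in the bound on \<open>M\<close> is used: \<open>L \<ge> 1\<close> needs \<open>2 powr (3/2) > exp 1\<close>.\<close>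
    moreover have "2 powr (3/2) * M powr (3/2) \<le> real n"
    proof -
      have "2 powr (3/2) * M powr (3/2) = (2 * M) powr (3/2)" using M by (simp add: powr_mult)
      also have "\<dots> \<le> (real n powr (2/3)) powr (3/2)" using M by (intro powr_mono2) auto
      also have "\<dots> = real n" using n by (simp add: powr_powr)
      finally show ?thesis .
    qed
    ultimately have "exp 1 \<le> exp L" using M32 unfolding expL
      by (simp add: pos_le_divide_eq) (meson M32 less_imp_le mult_right_mono order_trans)
    then show ?thesis by simp
  qed
  have R2: "R\<^sup>2 = D2\<^sup>2 * (M * L)" using M L1 by (simp add: R_def power_mult_distrib)
  have D2pos: "64 \<le> D2" using D1 D2 by simp
  have D2sq: "4096 * (1 + D1) \<le> D2\<^sup>2"
  proof -
    have "1 + D1 \<le> 1 + \<bar>lam\<bar> + D1" by simp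
    then have "(1 + D1)\<^sup>2 \<le> (1 + \<bar>lam\<bar> + D1)\<^sup>2" using D1 by (intro power_mono) auto
    moreover have "1 + D1 \<le> (1 + D1)\<^sup>2" using D1 by (intro self_le_power) auto
    moreover have "D2\<^sup>2 = 4096 * (1 + \<bar>lam\<bar> + D1)\<^sup>2"
      unfolding D2 by (simp only: power_mult_distrib) simp
    ultimately show ?thesis by (metis mult_left_mono order_trans zero_le_numeral)
  qed
  have R0: "0 \<le> R" using D2pos M L1 by (simp add: R_def)
  have RM: "768 * M \<le> R\<^sup>2"
  proof -
    have "768 \<le> D2\<^sup>2 * L" using mult_mono[of 768 "D2\<^sup>2" 1 L] D2sq D1 L1 by simp
    then have "768 * M \<le> D2\<^sup>2 * L * M" using M by (intro mult_right_mono) auto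
    then show ?thesis by (simp add: R2 mult_ac)
  qed
  have pdR: "p * (real d - 1) \<le> 1 + R / (64 * M)"
  proof -
    have "p * (real d - 1) \<le> 1 + lam / t" using pd[unfolded t(3)] d by (simp add: pos_le_divide_eq)
    also have "lam / t \<le> \<bar>lam\<bar> / t" using t by (intro divide_right_mono) auto
    also have "\<bar>lam\<bar> / t \<le> \<bar>lam\<bar> / sqrt M"
    proof -
      have "M \<le> t\<^sup>2" using M t by simp
      then have "sqrt M \<le> t" using t by (simp add: real_le_lsqrt)
      then show ?thesis using M t by (intro divide_left_mono) auto
    qed
    also have "\<bar>lam\<bar> / sqrt M \<le> D2 / 64 * (1 / sqrt M)"
    proof -
      have "\<bar>lam\<bar> \<le> D2 / 64" using D2 D1 by simp
      then have "\<bar>lam\<bar> * (1 / sqrt M) \<le> D2 / 64 * (1 / sqrt M)" using M by (intro mult_right_mono) auto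
      then show ?thesis by simp
    qed
    also have "1 / sqrt M \<le> sqrt (M * L) / M"
    proof -
      have "sqrt M * 1 \<le> sqrt M * sqrt L" using L1 M by (intro mult_left_mono) auto
      then have "sqrt M / M \<le> sqrt (M * L) / M" using M by (intro divide_right_mono) (auto simp: real_sqrt_mult)
      moreover have "sqrt M / M = 1 / sqrt M" using M by (simp add: field_simps)
      ultimately show ?thesis by simp
    qed
    finally have "p * (real d - 1) \<le> 1 + D2 / 64 * (sqrt (M * L) / M)" using D2pos by simp
    then show ?thesis by (simp add: R_def)
  qed
  have "measure_pmf.prob (percolation E p)
     {F. \<exists>C\<in>graph_components V F. real (card C) < M \<and> real (component_diam F C) > R}
    \<le> 48 * (real (card V) / M powr (3/2)) * exp (- R\<^sup>2 / (512 * M))"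
    using p by (intro prob_small_components_le[OF G(1) deg d(1) _ _ R0 M(1) RM pdR]) auto
  also have "\<dots> = 48 * exp L * exp (- D2\<^sup>2 * L / 512)"
    using M by (simp add: G(2) expL R2)
  also have "\<dots> \<le> exp (6 * L) * exp L * exp (- D2\<^sup>2 * L / 512)"
  proof (intro mult_right_mono)
    have "(2::real) ^ 6 \<le> exp 1 ^ 6" using exp_ge_add_one_self[of 1] by (intro power_mono) auto
    also have "\<dots> = exp 6" by (simp flip: exp_of_nat_mult)
    also have "\<dots> \<le> exp (6 * L)" using L1 by simp
    finally show "48 \<le> exp (6 * L)" by simp
  qed auto
  also have "\<dots> = exp (7 * L - D2\<^sup>2 / 512 * L)" by (simp add: mult_exp_exp)
  also have "\<dots> \<le> exp (- (D1 * L))"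
  proof -
    have "(7 + D1) * L \<le> D2\<^sup>2 / 512 * L" using D2sq L1 D1 by (intro mult_right_mono) auto
    then show ?thesis by (simp add: algebra_simps)
  qed
  also have "\<dots> = (M powr (3/2) / real n) powr D1"
    using n M32 by (simp add: powr_def L_def ln_div) (simp add: algebra_simps)
  finally show ?thesis by (simp add: R_def L_def)
qed

text \<open>The constant \<open>c\<close> makes \<open>q = c * n powr (-1/3)\<close> dominate the window, \<open>B\<close> makes the bound
  \<open>2 * c / B\<close> for components with at least \<open>B * n powr (2/3)\<close> vertices small, and \<open>A\<close> is so large
  compared with \<open>B\<close> that smaller components are unlikely to stretch to length
  \<open>A * n powr (1/3)\<close>.\<close>
lemma diameter_upper_probability_bound:
  fixes lam eps c B A p :: real
  assumes G: "simple_graph V E" "card V = n" and deg: "\<forall>v\<in>V. vertex_degree E v \<le> d"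
    and d: "3 \<le> d" "d \<le> n - 1" and p: "0 < p" "p < 1"
    and pd: "p \<le> (1 + lam * real n powr (-1/3)) / (real d - 1)"
    and eps: "0 < eps" and c: "c = 8 * (\<bar>lam\<bar> + 1)" and B: "B = 8 * c / eps + 1"
    and A: "A = 1000 * B * (1 + \<bar>lam\<bar> + 1 / eps)"
  shows "measure_pmf.prob (percolation E p)
     {F. \<exists>C\<in>graph_components V F. real (component_diam F C) > A * real n powr (1/3)} < eps"
proof -
  define t where "t = real n powr (1/3)"
  define R where "R = A * t"
  define r where "r = Suc (nat \<lfloor>R / 2\<rfloor>)"
  define M where "M = B * t\<^sup>2"
  define q where "q = c / t"
  let ?P = "measure_pmf.prob (percolation E p)"
  have n: "0 < real n" using d by simp
  then have t: "0 < t" "real n powr (-1/3) = 1 / t" "real n = t ^ 3"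
    by (auto simp: t_def powr_powr powr_minus_divide simp flip: powr_realpow)
  have c8: "8 \<le> c" using c by simp
  have B1: "1 \<le> B" using B c8 eps by simp
  have A1: "1000 * B \<le> A" "1000 * B * (1 + \<bar>lam\<bar>) \<le> A"
  proof -
    have "1000 * B * 1 \<le> A" unfolding A using B1 eps by (intro mult_left_mono) auto
    then show "1000 * B \<le> A" by simp
    show "1000 * B * (1 + \<bar>lam\<bar>) \<le> A" unfolding A using B1 eps by (intro mult_left_mono) auto
  qed
  have Asq: "1000000 * B\<^sup>2 \<le> A\<^sup>2" "1000000 * B\<^sup>2 / eps \<le> A\<^sup>2"
  proof -
    have "(1000 * B)\<^sup>2 \<le> A\<^sup>2" using A1 B1 by (intro power_mono) auto
    then show "1000000 * B\<^sup>2 \<le> A\<^sup>2" by (simp add: power_mult_distrib)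
    have "1 / eps \<le> (1 + \<bar>lam\<bar> + 1 / eps)\<^sup>2"
    proof -
      have "(1 + 1 / eps)\<^sup>2 \<le> (1 + \<bar>lam\<bar> + 1 / eps)\<^sup>2" using eps by (intro power_mono) auto
      moreover have "1 / eps \<le> (1 + 1 / eps)\<^sup>2" using eps by (simp add: power2_eq_square field_simps)
      ultimately show ?thesis by linarith
    qed
    then have "1000000 * B\<^sup>2 * (1 / eps) \<le> 1000000 * B\<^sup>2 * (1 + \<bar>lam\<bar> + 1 / eps)\<^sup>2"
      by (intro mult_left_mono) auto
    also have "\<dots> = A\<^sup>2" unfolding A by (simp only: power_mult_distrib) simp
    finally show "1000000 * B\<^sup>2 / eps \<le> A\<^sup>2" by simp
  qed
  have R0: "0 \<le> R" and r: "R / 2 \<le> real r" using A1 B1 t by (simp_all add: R_def r_def) linarith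
  have M0: "0 < M" using B1 t by (simp add: M_def)
  have pdlam: "p * (real d - 1) \<le> 1 + \<bar>lam\<bar> / t"
  proof -
    have "p * (real d - 1) \<le> 1 + lam / t" using pd[unfolded t(2)] d by (simp add: pos_le_divide_eq)
    also have "lam / t \<le> \<bar>lam\<bar> / t" using t by (intro divide_right_mono) auto
    finally show ?thesis by simp
  qed

  let ?large = "{F. \<exists>C\<in>graph_components V F. M \<le> real (card C) \<and> real (card C) \<le> real n
    \<and> R < real (component_diam F C)}"
  let ?small = "{F. \<exists>C\<in>graph_components V F. real (card C) < M \<and> real (component_diam F C) > R}"

  have large: "?P ?large \<le> eps / 4"
  proof -
    have surv: "?P {F. survives F {v} r \<and> real (explored F {v} r) \<le> real n} \<le> 2 * q" for v
    proof (cases "q \<le> 1")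
      case False
      have "?P {F. survives F {v} r \<and> real (explored F {v} r) \<le> real n} \<le> 1" by simp
      then show ?thesis using False by linarith
    next
      case True
      have q0: "0 < q" using c8 t by (simp add: q_def)
      have D: "real (d - 1) = real d - 1" "Suc (d - 1) = d" "2 \<le> d - 1" using d by (auto simp: of_nat_diff)
      have "\<bar>lam\<bar> / t \<le> q / 8" using t by (simp add: q_def c field_simps)
      then have pq: "p * real (d - 1) \<le> 1 + q / 8" using pdlam unfolding D(1) by linarith
      have front: "bfs_front (d - 1) E {v} 2"
        using simple_graph_facts[OF G(1) deg] D by (intro bfs_front_singleton) auto
      have "t \<le> real r"
      proof -
        have "2 * t \<le> R" unfolding R_def using A1 B1 t by (intro mult_right_mono) auto
        then show ?thesis using r by simp
      qed
      then have "8 / (real r + 8) \<le> 8 / t" using t by (intro divide_left_mono) auto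
      also have "\<dots> \<le> q" unfolding q_def using c8 t by (intro divide_right_mono) auto
      finally have mx: "max q (8 / (real r + 8)) = q" by simp
      have "?P {F. survives F {v} r \<and> real (explored F {v} r) \<le> real n} \<le> ?P {F. survives F {v} r}"
        by (intro measure_pmf.finite_measure_mono) auto
      also have "\<dots> \<le> 1 - (1 - q)\<^sup>2"
        using prob_survives_le_max[OF D(3) _ _ _ True pq front, of r] p q0 mx by simp
      also have "\<dots> \<le> 2 * q" by (simp add: power2_eq_square algebra_simps)
      finally show ?thesis .
    qed
    have "?P ?large \<le> real (card V) * (2 * q) / M"
      by (rule prob_components_between_le[OF G(1) M0 R0 r_def surv])
    also have "\<dots> = 2 * c / B" using t B1 unfolding G(2) t(3)
      by (simp add: M_def q_def field_simps power2_eq_square power3_eq_cube)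
    also have "\<dots> \<le> eps / 4"
    proof -
      have "8 * c \<le> eps * B" using B eps by (simp add: field_simps)
      then show ?thesis using B1 by (simp add: field_simps)
    qed
    finally show ?thesis .
  qed

  have small: "?P ?small \<le> eps / 4"
  proof -
    have R2: "R\<^sup>2 = A\<^sup>2 * t\<^sup>2" by (simp add: R_def power_mult_distrib)
    have RM: "768 * M \<le> R\<^sup>2"
    proof -
      have "B \<le> B\<^sup>2" using B1 by (intro self_le_power) auto
      then have "768 * B \<le> A\<^sup>2" using Asq B1 by linarith
      then have "768 * B * t\<^sup>2 \<le> A\<^sup>2 * t\<^sup>2" by (intro mult_right_mono) auto
      then show ?thesis by (simp add: R2 M_def)
    qed
    have "\<bar>lam\<bar> / t \<le> R / (64 * M)"
    proof -
      have "64 * B * \<bar>lam\<bar> \<le> 1000 * B * (1 + \<bar>lam\<bar>)" using B1 by (intro mult_mono) auto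
      also have "\<dots> \<le> A" by (rule A1(2))
      finally have "\<bar>lam\<bar> \<le> A / (64 * B)" using B1 by (simp add: pos_le_divide_eq mult_ac)
      then have "\<bar>lam\<bar> / t \<le> A / (64 * B) / t" using t by (intro divide_right_mono) auto
      also have "\<dots> = R / (64 * M)" using t B1 by (simp add: R_def M_def field_simps power2_eq_square)
      finally show ?thesis .
    qed
    then have pdR: "p * (real d - 1) \<le> 1 + R / (64 * M)" using pdlam by linarith
    have "?P ?small \<le> 48 * (real (card V) / M powr (3/2)) * exp (- R\<^sup>2 / (512 * M))"
      using p by (intro prob_small_components_le[OF G(1) deg d(1) _ _ R0 M0 RM pdR]) auto
    also have "\<dots> \<le> 48 * 1 * (512 * B / A\<^sup>2)"
    proof (intro mult_mono)
      have "(t powr 2) powr (3/2) = t powr 3" unfolding powr_powr by simp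
      then have "t ^ 3 = (t\<^sup>2) powr (3/2)" using t(1) by (simp add: powr_numeral)
      also have "\<dots> \<le> M powr (3/2)"
        using mult_right_mono[OF B1, of "t\<^sup>2"] unfolding M_def by (intro powr_mono2) auto
      finally show "real (card V) / M powr (3/2) \<le> 1" using M0 unfolding G(2) t(3) by simp
      have e: "- R\<^sup>2 / (512 * M) = - (A\<^sup>2 / (512 * B))"
        using t B1 by (simp add: R2 M_def)
      have y: "0 < A\<^sup>2 / (512 * B)" using A1 B1 by simp
      have "A\<^sup>2 / (512 * B) \<le> exp (A\<^sup>2 / (512 * B))"
        using exp_ge_add_one_self[of "A\<^sup>2 / (512 * B)"] by linarith
      then have "exp (- (A\<^sup>2 / (512 * B))) \<le> 1 / (A\<^sup>2 / (512 * B))"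
        using le_imp_inverse_le[OF _ y] unfolding exp_minus inverse_eq_divide by simp
      then show "exp (- R\<^sup>2 / (512 * M)) \<le> 512 * B / A\<^sup>2" unfolding e by simp
    qed auto
    also have "\<dots> \<le> eps / 4"
    proof -
      have "B \<le> B\<^sup>2" using B1 by (intro self_le_power) auto
      moreover have "1000000 * B\<^sup>2 \<le> eps * A\<^sup>2" using Asq(2) eps by (simp add: field_simps)
      ultimately have "98304 * B \<le> eps * A\<^sup>2" using B1 by linarith
      moreover have "0 < A\<^sup>2" using A1 B1 by simp
      ultimately show ?thesis by (simp add: field_simps)
    qed
    finally show ?thesis .
  qed

  have "?P {F. \<exists>C\<in>graph_components V F. real (component_diam F C) > R} \<le> ?P (?large \<union> ?small)"
  proof (intro measure_pmf.finite_measure_mono_AE AE_pmfI impI)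
    fix F assume F: "F \<in> set_pmf (percolation E p)"
    assume "F \<in> {F. \<exists>C\<in>graph_components V F. real (component_diam F C) > R}"
    then obtain C where C: "C \<in> graph_components V F" "R < real (component_diam F C)" by auto
    have "F \<subseteq> Pow V" using F set_percolation[of E p] simple_graph_facts(3)[OF G(1) deg] by auto
    then have "card C \<le> n"
      using component_subset[OF C(1)] simple_graph_facts(1)[OF G(1) deg] G(2) card_mono by blast
    then show "F \<in> ?large \<union> ?small" using C by (cases "real (card C) < M") auto
  qed auto
  also have "\<dots> \<le> ?P ?large + ?P ?small" by (intro measure_Un_le) auto
  also have "\<dots> < eps" using large small eps by linarith
  finally show ?thesis by (simp add: R_def t_def)
qed

theorem theorem1p3:
  fixes lam :: real
  shows "(\<forall>\<epsilon>>0. \<forall>\<beta>>(0::real). \<exists>A::real.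
           \<forall>(V::'a set) E (n::nat) (d::nat) p.
             simple_graph V E \<and> card V = n \<and> (\<forall>v\<in>V. vertex_degree E v \<le> d) \<and> 3 \<le> d \<and> d \<le> n - 1 \<and>
             0 < p \<and> p < 1 \<and> p \<le> (1 + lam * real n powr (-1/3)) / (real d - 1) \<longrightarrow>
             measure_pmf.prob (percolation E p)
               {F. \<exists>C\<in>graph_components V F. real (component_diam F C) > A * real n powr (1/3)} < \<epsilon>)
       \<and>
         (\<forall>D1>0. \<exists>D2>0.
           \<forall>(V::'a set) E (n::nat) (d::nat) p (M::real).
             simple_graph V E \<and> card V = n \<and> (\<forall>v\<in>V. vertex_degree E v \<le> d) \<and> 3 \<le> d \<and> d \<le> n - 1 \<and>
             0 < p \<and> p < 1 \<and> p \<le> (1 + lam * real n powr (-1/3)) / (real d - 1) \<and>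
             0 < M \<and> M < real n powr (2/3) / 2 \<longrightarrow>
             measure_pmf.prob (percolation E p)
               {F. \<exists>C\<in>graph_components V F. real (card C) < M \<and>
                    real (component_diam F C) > D2 * sqrt (M * ln (real n / M powr (3/2)))}
             \<le> (M powr (3/2) / real n) powr D1)"
proof (intro conjI allI impI)
  fix \<epsilon> \<beta> :: real
  assume "0 < \<epsilon>"
  then show "\<exists>A::real.
           \<forall>(V::'a set) E (n::nat) (d::nat) p.
             simple_graph V E \<and> card V = n \<and> (\<forall>v\<in>V. vertex_degree E v \<le> d) \<and> 3 \<le> d \<and> d \<le> n - 1 \<and>
             0 < p \<and> p < 1 \<and> p \<le> (1 + lam * real n powr (-1/3)) / (real d - 1) \<longrightarrow>
             measure_pmf.prob (percolation E p)
               {F. \<exists>C\<in>graph_components V F. real (component_diam F C) > A * real n powr (1/3)} < \<epsilon>"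
    using diameter_upper_probability_bound[where lam=lam, OF _ _ _ _ _ _ _ _ _ refl refl refl] by blast
next
  fix D1 :: real
  assume D1: "0 < D1"
  then have "0 < 64 * (1 + \<bar>lam\<bar> + D1)" by simp
  then show "\<exists>D2>0.
           \<forall>(V::'a set) E (n::nat) (d::nat) p (M::real).
             simple_graph V E \<and> card V = n \<and> (\<forall>v\<in>V. vertex_degree E v \<le> d) \<and> 3 \<le> d \<and> d \<le> n - 1 \<and>
             0 < p \<and> p < 1 \<and> p \<le> (1 + lam * real n powr (-1/3)) / (real d - 1) \<and>
             0 < M \<and> M < real n powr (2/3) / 2 \<longrightarrow>
             measure_pmf.prob (percolation E p)
               {F. \<exists>C\<in>graph_components V F. real (card C) < M \<and>
                    real (component_diam F C) > D2 * sqrt (M * ln (real n / M powr (3/2)))}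
             \<le> (M powr (3/2) / real n) powr D1"
    using diameter_tail_probability_bound[where lam=lam, OF _ _ _ _ _ _ _ _ D1 refl] by blast
qed

end
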